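(* Let $(X,d)$ be a compact separable metric space without isolated points and let $M$ be a defining structure of $(X,d)$ in a language $\mathcal{L}$. Suppose $\mu$ is a probability measure on $X$ compatible with $M$, that $\mathcal{L}$ is countable, and that thickness is definable in $M$. Then the set $$\{(x_n)_n\in X^{\mathbb{N}}: \{x_n: n\in\mathbb{N}\}\text{ is dense and independent}\}$$ is (measurable and) $\mu^{\mathbb{N}}$-conull.
   Context: Defining structure: an $\mathcal{L}$-structure $M$ is a defining structure of $(X,d)$ if $X\subseteq M^n$ is an $\mathcal{L}$-definable set for some $n\in\mathbb{N}$ and the binary relation $d(x,y)<1$ is $\mathcal{L}$-definable over $\emptyset$. Elements of $X$ are $n$-tuples of $M$, and $\varphi(X,\bar b)=\{x\in X: M\models\varphi(x,\bar b)\}$. Thick/thin: a definable subset $A\subseteq X$ is thick if it contains a non-empty open ball of $(X,d)$; otherwise it is thin. Thickness is definable in $M$ if for every $\mathcal{L}$-formula $\varphi(x,y)$ without parameters, with $|x|=n$ and $|y|=mn$, there is a formula $\psi(y)$ without parameters such that for every $\bar b\in X^m$: $M\models\psi(\bar b)$ iff $\varphi(X,\bar b)$ is thick. Independent: a subset $Y\subseteq X$ is independent if for every $\mathcal{L}$-formula $\varphi(x,y)$ with $|x|=n$ and $|y|=mn$ for some $m\in\mathbb{N}$, and every $\bar b\in Y^m$, if $\varphi(X,\bar b)$ is thin then $Y\cap\varphi(X,\bar b)\subseteq\bar b$ (the set of entries of $\bar b$). Compatible: a ($\sigma$-additive) probability measure $\mu$ on $X$ is compatible with $M$ if for all $k\in\mathbb{N}$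 the product measure $\mu^k$ measures all $\mathcal{L}$-definable subsets of $X^k$, and for every definable set $D\subseteq X$, $\mu(D)=0$ iff $D$ does not contain any open ball (i.e. $D$ is thin). $\mu^{\mathbb{N}}$ denotes the product measure on $X^{\mathbb{N}}$.
   Formalization: The formal theorem adds the hypothesis that every non-empty open ball of X has positive μ-measure (μ being Borel); without it the claim fails, e.g. X = M = [0,1/2], empty language, μ uniform on [0,1/4]. *)

theory Defs
  imports "HOL-Probability.Probability"
begin

section \<open>First-order logic\<close>

record ('f, 'r) fo_language =
  Funs :: "'f set"
  Rels :: "'r set"
  fun_arity :: "'f \<Rightarrow> nat"
  rel_arity :: "'r \<Rightarrow> nat"

definition countable_language :: "('f, 'r) fo_language \<Rightarrow> bool" where
  "countable_language L \<longleftrightarrow> countable (Funs L) \<and> countable (Rels L)"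

datatype 'f fo_term = Var nat | App 'f "'f fo_term list"

text \<open>Quantification is over a named variable: \<open>Ex v \<phi>\<close> binds variable number \<open>v\<close>.\<close>

datatype ('f, 'r) fo_formula =
    Eq "'f fo_term" "'f fo_term"
  | Rel 'r "'f fo_term list"
  | Neg "('f, 'r) fo_formula"
  | Conj "('f, 'r) fo_formula" "('f, 'r) fo_formula"
  | Ex nat "('f, 'r) fo_formula"

primrec term_of :: "('f, 'r) fo_language \<Rightarrow> 'f fo_term \<Rightarrow> bool" where
  "term_of L (Var v) \<longleftrightarrow> True"
| "term_of L (App f ts) \<longleftrightarrow>
     f \<in> Funs L \<and> length ts = fun_arity L f \<and> list_all (term_of L) ts"

primrec formula_of :: "('f, 'r) fo_language \<Rightarrow> ('f, 'r) fo_formula \<Rightarrow> bool" where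
  "formula_of L (Eq s t) \<longleftrightarrow> term_of L s \<and> term_of L t"
| "formula_of L (Rel r ts) \<longleftrightarrow>
     r \<in> Rels L \<and> length ts = rel_arity L r \<and> list_all (term_of L) ts"
| "formula_of L (Neg \<phi>) \<longleftrightarrow> formula_of L \<phi>"
| "formula_of L (Conj \<phi> \<psi>) \<longleftrightarrow> formula_of L \<phi> \<and> formula_of L \<psi>"
| "formula_of L (Ex v \<phi>) \<longleftrightarrow> formula_of L \<phi>"

primrec term_vars :: "'f fo_term \<Rightarrow> nat set" where
  "term_vars (Var v) = {v}"
| "term_vars (App f ts) = \<Union> (set (map term_vars ts))"

primrec free_vars :: "('f, 'r) fo_formula \<Rightarrow> nat set" where
  "free_vars (Eq s t) = term_vars s \<union> term_vars t"
| "free_vars (Rel r ts) = \<Union> (set (map term_vars ts))"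
| "free_vars (Neg \<phi>) = free_vars \<phi>"
| "free_vars (Conj \<phi> \<psi>) = free_vars \<phi> \<union> free_vars \<psi>"
| "free_vars (Ex v \<phi>) = free_vars \<phi> - {v}"

text \<open>An \<open>L\<close>-formula \<open>\<phi>(v\<^sub>0, \<dots>, v\<^bsub>N-1\<^esub>)\<close>.\<close>

definition formula_in :: "('f, 'r) fo_language \<Rightarrow> nat \<Rightarrow> ('f, 'r) fo_formula \<Rightarrow> bool" where
  "formula_in L N \<phi> \<longleftrightarrow> formula_of L \<phi> \<and> free_vars \<phi> \<subseteq> {..<N}"

record ('a, 'f, 'r) fo_structure =
  Dom :: "'a set"
  fun_interp :: "'f \<Rightarrow> 'a list \<Rightarrow> 'a"
  rel_interp :: "'r \<Rightarrow> 'a list \<Rightarrow> bool"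

definition structure_of ::
    "('f, 'r) fo_language \<Rightarrow> ('a, 'f, 'r) fo_structure \<Rightarrow> bool" where
  "structure_of L M \<longleftrightarrow> Dom M \<noteq> {} \<and>
     (\<forall>f \<in> Funs L. \<forall>as. length as = fun_arity L f \<and> set as \<subseteq> Dom M
        \<longrightarrow> fun_interp M f as \<in> Dom M)"

primrec term_val :: "('a, 'f, 'r) fo_structure \<Rightarrow> (nat \<Rightarrow> 'a) \<Rightarrow> 'f fo_term \<Rightarrow> 'a" where
  "term_val M e (Var v) = e v"
| "term_val M e (App f ts) = fun_interp M f (map (term_val M e) ts)"

primrec sat :: "('a, 'f, 'r) fo_structure \<Rightarrow> (nat \<Rightarrow> 'a) \<Rightarrow> ('f, 'r) fo_formula \<Rightarrow> bool" where
  "sat M e (Eq s t) \<longleftrightarrow> term_val M e s = term_val M e t"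
| "sat M e (Rel r ts) \<longleftrightarrow> rel_interp M r (map (term_val M e) ts)"
| "sat M e (Neg \<phi>) \<longleftrightarrow> \<not> sat M e \<phi>"
| "sat M e (Conj \<phi> \<psi>) \<longleftrightarrow> sat M e \<phi> \<and> sat M e \<psi>"
| "sat M e (Ex v \<phi>) \<longleftrightarrow> (\<exists>a \<in> Dom M. sat M (e(v := a)) \<phi>)"

text \<open>
  \<open>M \<Turnstile> \<phi>(as)\<close>, where variable number \<open>i\<close> takes the value \<open>as ! i\<close>. It is only applied to
  formulas whose free variables are smaller than \<open>length as\<close>, so the unspecified values of
  \<open>as ! i\<close> beyond the length play no role.
\<close>

definition models :: "('a, 'f, 'r) fo_structure \<Rightarrow> ('f, 'r) fo_formula \<Rightarrow> 'a list \<Rightarrow> bool" where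
  "models M \<phi> as \<longleftrightarrow> sat M (\<lambda>i. as ! i) \<phi>"

definition tuples :: "'a set \<Rightarrow> nat \<Rightarrow> 'a list set" where
  "tuples A N = {as. length as = N \<and> set as \<subseteq> A}"

text \<open>Definability of \<open>D \<subseteq> M\<^sup>N\<close> with parameters from \<open>A\<close>; ``definable'' means \<open>A = Dom M\<close>.\<close>

definition definable_over :: "('f, 'r) fo_language \<Rightarrow> ('a, 'f, 'r) fo_structure \<Rightarrow>
    'a set \<Rightarrow> nat \<Rightarrow> 'a list set \<Rightarrow> bool" where
  "definable_over L M A N D \<longleftrightarrow>
     (\<exists>\<phi> cs. set cs \<subseteq> A \<and> formula_in L (N + length cs) \<phi> \<and>
        D = {as \<in> tuples (Dom M) N. models M \<phi> (as @ cs)})"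

abbreviation definable :: "('f, 'r) fo_language \<Rightarrow> ('a, 'f, 'r) fo_structure \<Rightarrow>
    nat \<Rightarrow> 'a list set \<Rightarrow> bool" where
  "definable L M \<equiv> definable_over L M (Dom M)"


section \<open>Metric spaces definable in a structure\<close>

text \<open>Points of \<open>X \<subseteq> M\<^sup>n\<close> are lists of length \<open>n\<close>; a tuple of points is identified with the
  concatenation of its entries whenever formulas are evaluated at it.\<close>

definition defining_structure :: "('f, 'r) fo_language \<Rightarrow> ('a, 'f, 'r) fo_structure \<Rightarrow> nat \<Rightarrow>
    'a list set \<Rightarrow> ('a list \<Rightarrow> 'a list \<Rightarrow> real) \<Rightarrow> bool" where
  "defining_structure L M n X d \<longleftrightarrow>
     structure_of L M \<and> definable L M n X \<and>
     definable_over L M {} (2 * n) {x @ y | x y. x \<in> X \<and> y \<in> X \<and> d x y < 1}"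

definition thick :: "'x set \<Rightarrow> ('x \<Rightarrow> 'x \<Rightarrow> real) \<Rightarrow> 'x set \<Rightarrow> bool" where
  "thick X d A \<longleftrightarrow> (\<exists>x \<in> X. \<exists>r > 0. Metric_space.mball X d x r \<subseteq> A)"

abbreviation thin :: "'x set \<Rightarrow> ('x \<Rightarrow> 'x \<Rightarrow> real) \<Rightarrow> 'x set \<Rightarrow> bool" where
  "thin X d A \<equiv> \<not> thick X d A"

text \<open>The set \<open>\<phi>(X, b)\<close>.\<close>

definition solutions :: "('a, 'f, 'r) fo_structure \<Rightarrow> 'a list set \<Rightarrow> ('f, 'r) fo_formula \<Rightarrow>
    'a list list \<Rightarrow> 'a list set" where
  "solutions M X \<phi> bs = {x \<in> X. models M \<phi> (x @ concat bs)}"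

definition thickness_definable :: "('f, 'r) fo_language \<Rightarrow> ('a, 'f, 'r) fo_structure \<Rightarrow> nat \<Rightarrow>
    'a list set \<Rightarrow> ('a list \<Rightarrow> 'a list \<Rightarrow> real) \<Rightarrow> bool" where
  "thickness_definable L M n X d \<longleftrightarrow>
     (\<forall>m \<phi>. formula_in L (n + m * n) \<phi> \<longrightarrow>
        (\<exists>\<psi>. formula_in L (m * n) \<psi> \<and>
           (\<forall>bs \<in> tuples X m. models M \<psi> (concat bs) \<longleftrightarrow> thick X d (solutions M X \<phi> bs))))"

definition independent_points :: "('f, 'r) fo_language \<Rightarrow> ('a, 'f, 'r) fo_structure \<Rightarrow> nat \<Rightarrow>
    'a list set \<Rightarrow> ('a list \<Rightarrow> 'a list \<Rightarrow> real) \<Rightarrow> 'a list set \<Rightarrow> bool" where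
  "independent_points L M n X d Y \<longleftrightarrow>
     (\<forall>m \<phi>. formula_in L (n + m * n) \<phi> \<longrightarrow>
        (\<forall>bs \<in> tuples Y m. thin X d (solutions M X \<phi> bs) \<longrightarrow>
           Y \<inter> solutions M X \<phi> bs \<subseteq> set bs))"

definition borel_probability_on ::
    "'x set \<Rightarrow> ('x \<Rightarrow> 'x \<Rightarrow> real) \<Rightarrow> 'x measure \<Rightarrow> bool" where
  "borel_probability_on X d \<mu> \<longleftrightarrow>
     prob_space \<mu> \<and> space \<mu> = X \<and>
     (\<forall>U. openin (Metric_space.mtopology X d) U \<longrightarrow> U \<in> sets \<mu>)"

text \<open>
  Points of \<open>X\<^sup>k\<close> are functions on \<open>{..<k}\<close>, as for the product measure. The case \<open>k = 1\<close> of the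
  first conjunct makes every definable \<open>D \<subseteq> X\<close> measurable, so \<open>emeasure \<mu> D = 0\<close> does not hold
  for the trivial reason that \<open>D\<close> is not measurable.
\<close>

definition compatible :: "('f, 'r) fo_language \<Rightarrow> ('a, 'f, 'r) fo_structure \<Rightarrow> nat \<Rightarrow>
    'a list set \<Rightarrow> ('a list \<Rightarrow> 'a list \<Rightarrow> real) \<Rightarrow> 'a list measure \<Rightarrow> bool" where
  "compatible L M n X d \<mu> \<longleftrightarrow>
     (\<forall>k. \<forall>E \<subseteq> (\<Pi>\<^sub>E i \<in> {..<k}. X).
        definable L M (k * n) ((\<lambda>x. concat (map x [0..<k])) ` E) \<longrightarrow>
        E \<in> sets (\<Pi>\<^sub>M i \<in> {..<k}. \<mu>)) \<and>
     (\<forall>D \<subseteq> X. definable L M n D \<longrightarrow> (emeasure \<mu> D = 0 \<longleftrightarrow> thin X d D))"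

text \<open>
  Compatibility only constrains definable sets, and a defining structure need not define balls of
  radius other than 1, so compatibility alone does not give positive measure to every ball.
  Example: \<open>X = M = [0, 1/2]\<close> in the empty language, with \<open>\<mu>\<close> uniform on \<open>[0, 1/4]\<close>; the definable
  subsets of \<open>X\<close> are the finite and the cofinite ones.
\<close>

definition full_support :: "'x set \<Rightarrow> ('x \<Rightarrow> 'x \<Rightarrow> real) \<Rightarrow> 'x measure \<Rightarrow> bool" where
  "full_support X d \<mu> \<longleftrightarrow>
     (\<forall>x \<in> X. \<forall>r > 0. emeasure \<mu> (Metric_space.mball X d x r) \<noteq> 0)"

definition dense_in_space :: "'x set \<Rightarrow> ('x \<Rightarrow> 'x \<Rightarrow> real) \<Rightarrow> 'x set \<Rightarrow> bool" where
  "dense_in_space X d Y \<longleftrightarrow> Metric_space.mtopology X d closure_of Y = X"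

end

(* Density and independence of the range of x are countable conjunctions of conditions on x: meeting
   every member of a countable base, and, for every formula phi, tuple of indices is and index j,
   not having x_j in phi(X, x_is) when this set is thin and x_j is not one of the x_is. The first
   conditions hold almost surely because open sets have positive measure. For the second, definability
   of thickness together with compatibility gives measurability. If j occurs in is there is nothing
   to prove, and otherwise the section in the j-th coordinate lies in a thin set, which is null by
   compatibility, so Fubini applies. *)

theory Submission
  imports Defs
begin

section \<open>Syntax\<close>

instance fo_term :: (countable) countable
  by countable_datatype

instance fo_formula :: (countable, countable) countable
  by countable_datatype

lemma term_of_set: "term_of L t \<Longrightarrow> set_fo_term t \<subseteq> Funs L"
  by (induction t) (auto simp: list_all_iff)

lemma formula_of_sets:
  "formula_of L \<phi> \<Longrightarrow> set1_fo_formula \<phi> \<subseteq> Funs L \<and> set2_fo_formula \<phi> \<subseteq> Rels L"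
  by (induction \<phi>) (auto simp: list_all_iff dest: subsetD[OF term_of_set])

text \<open>The types of symbols may be uncountable even though \<open>L\<close> uses only countably
  many of their elements. Coding the symbols of \<open>L\<close> by natural numbers sends its
  formulas injectively to formulas over \<open>nat\<close>, and these form a countable type.\<close>

lemma countable_formulas:
  assumes "countable_language L"
  shows "countable {\<phi>. formula_of L \<phi>}"
proof -
  obtain f :: "'a \<Rightarrow> nat" and g :: "'b \<Rightarrow> nat"
    where fg: "inj_on f (Funs L)" "inj_on g (Rels L)"
    using assms by (auto simp: countable_language_def countable_def)
  have "inj_on (map_fo_formula f g) {\<phi>. formula_of L \<phi>}"
  proof (rule inj_onI)
    fix \<phi> \<psi> :: "('a, 'b) fo_formula"
    assume "\<phi> \<in> {\<phi>. formula_of L \<phi>}" "\<psi> \<in> {\<phi>. formula_of L \<phi>}"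
      and eq: "map_fo_formula f g \<phi> = map_fo_formula f g \<psi>"
    then have "set1_fo_formula \<phi> \<subseteq> Funs L" "set2_fo_formula \<phi> \<subseteq> Rels L"
      "set1_fo_formula \<psi> \<subseteq> Funs L" "set2_fo_formula \<psi> \<subseteq> Rels L"
      using formula_of_sets by auto
    then show "\<phi> = \<psi>"
      \<comment> \<open>The codings have to be injective only on symbols that occur in the two
        formulas, and all of these belong to \<open>L\<close>.\<close>
      using eq fg by (intro fo_formula.inj_map_strong[OF _ _ eq]) (blast dest: inj_onD)+
  qed
  then show ?thesis
    by (rule countableI')
qed

primrec rename_term :: "(nat \<Rightarrow> nat) \<Rightarrow> 'f fo_term \<Rightarrow> 'f fo_term" where
  "rename_term \<sigma> (Var v) = Var (\<sigma> v)"
| "rename_term \<sigma> (App f ts) = App f (map (rename_term \<sigma>) ts)"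

text \<open>Bound variables are renamed as well, so that no capture occurs when \<open>\<sigma>\<close> is injective.\<close>

primrec rename :: "(nat \<Rightarrow> nat) \<Rightarrow> ('f, 'r) fo_formula \<Rightarrow> ('f, 'r) fo_formula" where
  "rename \<sigma> (Eq s t) = Eq (rename_term \<sigma> s) (rename_term \<sigma> t)"
| "rename \<sigma> (Rel r ts) = Rel r (map (rename_term \<sigma>) ts)"
| "rename \<sigma> (Neg \<phi>) = Neg (rename \<sigma> \<phi>)"
| "rename \<sigma> (Conj \<phi> \<psi>) = Conj (rename \<sigma> \<phi>) (rename \<sigma> \<psi>)"
| "rename \<sigma> (Ex v \<phi>) = Ex (\<sigma> v) (rename \<sigma> \<phi>)"

lemma term_val_rename: "term_val M e (rename_term \<sigma> t) = term_val M (e \<circ> \<sigma>) t"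
  by (induction t) (simp_all cong: map_cong)

lemma sat_rename:
  assumes "inj \<sigma>"
  shows "sat M e (rename \<sigma> \<phi>) \<longleftrightarrow> sat M (e \<circ> \<sigma>) \<phi>"
proof (induction \<phi> arbitrary: e)
  case (Ex v \<phi>)
  \<comment> \<open>By injectivity, changing the value at \<open>\<sigma> v\<close> affects the
    composed assignment at \<open>v\<close> alone.\<close>
  have *: "e(\<sigma> v := a) \<circ> \<sigma> = (e \<circ> \<sigma>)(v := a)" for a
    using assms by (auto simp: fun_eq_iff inj_eq)
  show ?case
    by (simp only: rename.simps sat.simps Ex.IH *)
qed (simp_all add: term_val_rename comp_def)

lemma term_of_rename: "term_of L (rename_term \<sigma> t) \<longleftrightarrow> term_of L t"
  by (induction t) (auto simp: list_all_iff)

lemma formula_of_rename: "formula_of L (rename \<sigma> \<phi>) \<longleftrightarrow> formula_of L \<phi>"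
  by (induction \<phi>) (auto simp: term_of_rename list_all_iff)

lemma term_vars_rename: "term_vars (rename_term \<sigma> t) = \<sigma> ` term_vars t"
  by (induction t) auto

lemma free_vars_rename:
  assumes "inj \<sigma>"
  shows "free_vars (rename \<sigma> \<phi>) = \<sigma> ` free_vars \<phi>"
  by (induction \<phi>) (auto simp: term_vars_rename image_Un image_UN image_set_diff[OF assms])

lemma term_val_cong:
  "(\<And>v. v \<in> term_vars t \<Longrightarrow> e v = e' v) \<Longrightarrow> term_val M e t = term_val M e' t"
proof (induction t)
  case (App f ts)
  have "map (term_val M e) ts = map (term_val M e') ts"
    using App.prems by (intro map_cong refl App.IH) auto
  then show ?case
    by (simp only: term_val.simps)
qed simp

lemma sat_cong:
  "(\<And>v. v \<in> free_vars \<phi> \<Longrightarrow> e v = e' v) \<Longrightarrow> sat M e \<phi> \<longleftrightarrow> sat M e' \<phi>"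
proof (induction \<phi> arbitrary: e e')
  case (Eq s t)
  then show ?case
    using term_val_cong[of s e e' M] term_val_cong[of t e e' M] by simp
next
  case (Rel r ts)
  then have "map (term_val M e) ts = map (term_val M e') ts"
    by (auto intro!: term_val_cong)
  then show ?case
    by (simp only: sat.simps)
next
  case (Neg \<phi>)
  from Neg.IH[of e e'] Neg.prems show ?case
    by simp
next
  case (Conj \<phi> \<psi>)
  from Conj.IH(1)[of e e'] Conj.IH(2)[of e e'] Conj.prems show ?case
    by simp
next
  case (Ex v \<phi>)
  have "sat M (e(v := a)) \<phi> \<longleftrightarrow> sat M (e'(v := a)) \<phi>" for a
    by (rule Ex.IH) (use Ex.prems in auto)
  then show ?case
    by simp
qed

lemma formula_in_mono: "formula_in L N \<phi> \<Longrightarrow> N \<le> N' \<Longrightarrow> formula_in L N' \<phi>"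
  unfolding formula_in_def by force

text \<open>No free variable points beyond \<open>as\<close>, so trailing entries are never read.
  This allows a formula that ignores \<open>cs\<close> to be conjoined with one that uses
  \<open>cs\<close>.\<close>

lemma models_append:
  "formula_in L (length as) \<phi> \<Longrightarrow> models M \<phi> (as @ cs) \<longleftrightarrow> models M \<phi> as"
  unfolding models_def by (rule sat_cong) (auto simp: formula_in_def nth_append)

lemma sat_foldr_Conj:
  "sat M e (foldr Conj \<phi>s \<phi>) \<longleftrightarrow> (\<forall>\<psi> \<in> set \<phi>s. sat M e \<psi>) \<and> sat M e \<phi>"
  by (induction \<phi>s) auto

lemma formula_in_foldr_Conj:
  "formula_in L N (foldr Conj \<phi>s \<phi>) \<longleftrightarrow> (\<forall>\<psi> \<in> set \<phi>s. formula_in L N \<psi>) \<and> formula_in L N \<phi>"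
  by (induction \<phi>s) (auto simp: formula_in_def)


section \<open>Concatenated tuples\<close>

lemma length_concat_tuples: "bs \<in> tuples X m \<Longrightarrow> X \<subseteq> tuples A n \<Longrightarrow> length (concat bs) = m * n"
proof (induction m arbitrary: bs)
  case (Suc m)
  then obtain b bs' where "bs = b # bs'" "bs' \<in> tuples X m" "b \<in> X"
    by (cases bs) (auto simp: tuples_def)
  with Suc show ?case
    by (auto simp: tuples_def)
qed (simp add: tuples_def)

lemma concat_in_tuples:
  assumes "bs \<in> tuples X m" "X \<subseteq> tuples A n"
  shows "concat bs \<in> tuples A (m * n)"
  using length_concat_tuples[OF assms] assms by (fastforce simp: tuples_def)

text \<open>All entries have length \<open>n\<close>, so entry \<open>i\<close> starts at position
  \<open>i * n\<close>. Hence concatenation loses no information about a tuple of points;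
  \<open>concat_blocks\<close> is the other direction.\<close>

lemma take_drop_concat:
  "X \<subseteq> tuples A n \<Longrightarrow> bs \<in> tuples X m \<Longrightarrow> i < m \<Longrightarrow> take n (drop (i * n) (concat bs)) = bs ! i"
proof (induction m arbitrary: bs i)
  case (Suc m)
  then obtain b bs' where "bs = b # bs'" "bs' \<in> tuples X m" "b \<in> X"
    by (cases bs) (auto simp: tuples_def)
  with Suc show ?case
    by (cases i) (auto simp: tuples_def)
qed simp

lemma concat_blocks:
  "length as = m * n \<Longrightarrow> concat (map (\<lambda>i. take n (drop (i * n) as)) [0..<m]) = as"
proof (induction m arbitrary: as)
  case (Suc m)
  \<comment> \<open>The first block is split off; the remaining ones are the blocks of
    \<open>drop n as\<close>, to which the induction hypothesis applies.\<close>
  have "concat (map (\<lambda>i. take n (drop (i * n) as)) [0..<Suc m])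
      = take n as @ concat (map (\<lambda>i. take n (drop (i * n) (drop n as))) [0..<m])"
    by (simp only: upt_conv_Cons zero_less_Suc list.map concat.simps map_Suc_upt[symmetric] map_map
          comp_def mult_Suc drop_drop drop_0 mult_0 add.commute)
  also have "\<dots> = as"
    using Suc by (subst Suc.IH) auto
  finally show ?case .
qed simp


section \<open>Definable sets\<close>

text \<open>Moves the formula \<open>\<xi>(x, c)\<close> with \<open>|x| = n\<close> to the \<open>i\<close>-th block of an \<open>N\<close>-tuple that is followed
  by the parameters \<open>c\<close>.\<close>

definition shift_block :: "nat \<Rightarrow> nat \<Rightarrow> nat \<Rightarrow> nat \<Rightarrow> nat" where
  "shift_block n N i v = (if v < n then i * n + v else N + (v - n))"

text \<open>The block stays below \<open>N\<close> while the parameters go to \<open>N\<close> and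
  beyond, so the two ranges are disjoint.\<close>

lemma inj_shift_block:
  assumes "i * n + n \<le> N"
  shows "inj (shift_block n N i)"
  using assms by (intro injI) (auto simp: shift_block_def split: if_splits)

lemma models_rename_shift_block:
  assumes "formula_in L (n + length cs) \<xi>" "i * n + n \<le> N" "length as = N"
  shows "models M (rename (shift_block n N i) \<xi>) (as @ cs)
    \<longleftrightarrow> models M \<xi> (take n (drop (i * n) as) @ cs)"
  unfolding models_def sat_rename[OF inj_shift_block[OF assms(2)]]
proof (rule sat_cong)
  fix v assume "v \<in> free_vars \<xi>"
  then have "v < n + length cs"
    using assms by (auto simp: formula_in_def)
  then show "((!) (as @ cs) \<circ> shift_block n N i) v = (take n (drop (i * n) as) @ cs) ! v"
    using assms by (auto simp: shift_block_def nth_append)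
qed

lemma formula_in_rename_shift_block:
  assumes "formula_in L (n + l) \<xi>" "i * n + n \<le> N"
  shows "formula_in L (N + l) (rename (shift_block n N i) \<xi>)"
  using assms
  by (force simp: formula_in_def formula_of_rename free_vars_rename[OF inj_shift_block[OF assms(2)]]
      shift_block_def)

lemma definable_subset_tuples: "definable L M N X \<Longrightarrow> X \<subseteq> tuples (Dom M) N"
  by (auto simp: definable_over_def)

text \<open>This is the form of definability that compatibility turns into measurability in a finite
  power of \<open>X\<close>. Since \<open>X\<close> may itself be defined with parameters
  \<open>cs\<close>, its formula is copied to each of the \<open>k\<close> blocks, all copies share
  one list \<open>cs\<close> placed after the last block, and \<open>\<phi>\<close> is added as a
  further conjunct.\<close>

lemma definable_power_Collect:
  assumes X: "definable L M n X" and \<phi>: "formula_in L (k * n) \<phi>"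
  shows "definable L M (k * n) ((\<lambda>x. concat (map x [0..<k])) `
    {x \<in> \<Pi>\<^sub>E i\<in>{..<k}. X. models M \<phi> (concat (map x [0..<k]))})" (is "definable _ _ _ (?c ` ?E)")
proof -
  obtain \<xi> cs where cs: "set cs \<subseteq> Dom M" and \<xi>: "formula_in L (n + length cs) \<xi>"
    and X_eq: "X = {as \<in> tuples (Dom M) n. models M \<xi> (as @ cs)}"
    using X by (auto simp: definable_over_def)
  have X_sub: "X \<subseteq> tuples (Dom M) n"
    using X_eq by auto
  define \<theta> where "\<theta> = foldr Conj (map (\<lambda>i. rename (shift_block n (k * n) i) \<xi>) [0..<k]) \<phi>"
  have block: "i * n + n \<le> k * n" if "i < k" for i
    using that by (metis Suc_leI add.commute mult_Suc mult_le_mono1)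
  have \<theta>: "formula_in L (k * n + length cs) \<theta>"
    unfolding \<theta>_def formula_in_foldr_Conj
    using formula_in_mono[OF \<phi>] formula_in_rename_shift_block[OF \<xi> block] by simp
  have sat_\<theta>: "models M \<theta> (as @ cs) \<longleftrightarrow>
      (\<forall>i<k. models M \<xi> (take n (drop (i * n) as) @ cs)) \<and> models M \<phi> as"
    if "length as = k * n" for as
  proof -
    have "models M \<theta> (as @ cs) \<longleftrightarrow>
        (\<forall>i<k. models M (rename (shift_block n (k * n) i) \<xi>) (as @ cs)) \<and> models M \<phi> (as @ cs)"
      by (auto simp: models_def \<theta>_def sat_foldr_Conj)
    then show ?thesis
      using models_rename_shift_block[OF \<xi> block that] models_append[of L as \<phi> M cs] \<phi> that
      by simp
  qed
  have "?c ` ?E = {as \<in> tuples (Dom M) (k * n). models M \<theta> (as @ cs)}"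
  proof (intro equalityI subsetI)
    fix as assume "as \<in> ?c ` ?E"
    then obtain x where x: "\<And>i. i < k \<Longrightarrow> x i \<in> X" "models M \<phi> (?c x)" and as: "as = ?c x"
      by (elim imageE CollectE conjE) (auto simp: PiE_iff)
    have tup: "map x [0..<k] \<in> tuples X k"
      using x by (auto simp: tuples_def)
    have dom: "?c x \<in> tuples (Dom M) (k * n)"
      using concat_in_tuples[OF tup X_sub] .
    then have len: "length (?c x) = k * n"
      by (simp add: tuples_def)
    have "models M \<xi> (x i @ cs)" if "i < k" for i
      using x(1)[OF that] X_eq by blast
    then have "models M \<theta> (?c x @ cs)"
      using x(2) take_drop_concat[OF X_sub tup] unfolding sat_\<theta>[OF len] by simp
    with dom show "as \<in> {as \<in> tuples (Dom M) (k * n). models M \<theta> (as @ cs)}"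
      unfolding as by blast
  next
    fix as assume "as \<in> {as \<in> tuples (Dom M) (k * n). models M \<theta> (as @ cs)}"
    then have as: "as \<in> tuples (Dom M) (k * n)" "models M \<theta> (as @ cs)"
      by auto
    \<comment> \<open>The blocks of the list serve as coordinates; the restriction to
      \<open>{..<k}\<close> makes the function extensional, as membership in the product
      requires.\<close>
    define x where "x = (\<lambda>i\<in>{..<k}. take n (drop (i * n) as))"
    have len: "length as = k * n"
      using as by (simp add: tuples_def)
    have "map x [0..<k] = map (\<lambda>i. take n (drop (i * n) as)) [0..<k]"
      by (simp add: x_def)
    then have c: "?c x = as"
      using concat_blocks[OF len] by (simp only:)
    have "take n (drop (i * n) as) \<in> X" if "i < k" for i
    proof -
      have "set (take n (drop (i * n) as)) \<subseteq> Dom M"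
        using as(1) set_take_subset set_drop_subset unfolding tuples_def by fast
      moreover have "length (take n (drop (i * n) as)) = n"
        using len block[OF that] by simp
      ultimately show ?thesis
        using as(2) that unfolding sat_\<theta>[OF len] X_eq by (simp add: tuples_def)
    qed
    then have "x \<in> (\<Pi>\<^sub>E i\<in>{..<k}. X)"
      by (simp add: x_def)
    moreover have "models M \<phi> (?c x)"
      using as(2) unfolding sat_\<theta>[OF len] c by simp
    ultimately show "as \<in> ?c ` ?E"
      using c by (intro image_eqI[of _ _ x]) simp_all
  qed
  with \<theta> cs show ?thesis
    unfolding definable_over_def by blast
qed

text \<open>Compatibility equates null and thin for definable sets only, so these sets have to be
  shown definable. The points \<open>bs\<close> become parameters, followed by those in the
  definition of \<open>X\<close>.\<close>

lemma definable_solutions: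
  assumes X: "definable L M n X" and \<phi>: "formula_in L (n + m * n) \<phi>" and bs: "bs \<in> tuples X m"
  shows "definable L M n (solutions M X \<phi> bs)"
proof -
  obtain \<xi> cs where cs: "set cs \<subseteq> Dom M" and \<xi>: "formula_in L (n + length cs) \<xi>"
    and X_eq: "X = {as \<in> tuples (Dom M) n. models M \<xi> (as @ cs)}"
    using X by (auto simp: definable_over_def)
  have b: "concat bs \<in> tuples (Dom M) (m * n)"
    using concat_in_tuples[OF bs definable_subset_tuples[OF X]] .
  \<comment> \<open>Block \<open>0\<close> leaves the variables of the point in place; only the
    parameters \<open>cs\<close> of \<open>\<xi>\<close> move, past the \<open>m * n\<close>
    variables taken by \<open>concat bs\<close>.\<close>
  define \<theta> where "\<theta> = Conj (rename (shift_block n (n + m * n) 0) \<xi>) \<phi>"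
  have "formula_in L (n + m * n + length cs) (rename (shift_block n (n + m * n) 0) \<xi>)"
    by (rule formula_in_rename_shift_block[OF \<xi>]) simp
  then have "formula_in L (n + length (concat bs @ cs)) \<theta>"
    using formula_in_mono[OF \<phi>, of "n + m * n + length cs"] b
    by (auto simp: formula_in_def \<theta>_def tuples_def add.assoc)
  moreover have "solutions M X \<phi> bs = {as \<in> tuples (Dom M) n. models M \<theta> (as @ concat bs @ cs)}"
  proof -
    have "models M \<theta> (as @ concat bs @ cs) \<longleftrightarrow> models M \<xi> (as @ cs) \<and> models M \<phi> (as @ concat bs)"
      if "as \<in> tuples (Dom M) n" for as
      using models_rename_shift_block[OF \<xi>, of 0 "n + m * n" "as @ concat bs" M]
        models_append[of L "as @ concat bs" \<phi> M cs] that b \<phi>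
      by (simp add: \<theta>_def models_def tuples_def)
    then show ?thesis
      by (auto simp: solutions_def X_eq)
  qed
  moreover have "set (concat bs @ cs) \<subseteq> Dom M"
    using b cs by (auto simp: tuples_def)
  ultimately show ?thesis
    unfolding definable_over_def by blast
qed


section \<open>Null sets in sequence space\<close>

text \<open>Fubini for a single coordinate: replacing the \<open>j\<close>-th entry of a random
  sequence by an independent sample from \<open>\<mu>\<close> does not change the distribution of
  the sequence.\<close>

lemma AE_PiM_update:
  fixes \<mu> :: "'x measure"
  assumes "prob_space \<mu>"
    and [measurable]: "Measurable.pred (\<Pi>\<^sub>M i\<in>(UNIV :: nat set). \<mu>) P"
    and AE: "\<And>z. z \<in> space (\<Pi>\<^sub>M i\<in>(UNIV :: nat set). \<mu>) \<Longrightarrow> AE y in \<mu>. P (z(j := y))"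
  shows "AE x in \<Pi>\<^sub>M i\<in>(UNIV :: nat set). \<mu>. P x"
proof -
  let ?S = "\<Pi>\<^sub>M i\<in>(UNIV :: nat set). \<mu>"
  interpret prob_space \<mu> by fact
  interpret S: prob_space ?S
    by (rule prob_space_PiM) (rule assms(1))
  interpret pair_sigma_finite ?S \<mu> ..
  interpret sw: pair_sigma_finite \<mu> ?S ..
  have upd[measurable]: "(\<lambda>(y, z). z(j := y)) \<in> measurable (\<mu> \<Otimes>\<^sub>M ?S) ?S"
    unfolding split_def using measurable_fun_upd[of UNIV UNIV j snd "\<mu> \<Otimes>\<^sub>M ?S" "\<lambda>_. \<mu>" fst] by simp
  have "Measurable.pred (\<mu> \<Otimes>\<^sub>M ?S) (\<lambda>p. P (case p of (y, z) \<Rightarrow> z(j := y)))"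
    by (rule measurable_compose[OF upd assms(2)])
  then have pred: "{p \<in> space (\<mu> \<Otimes>\<^sub>M ?S). P ((snd p)(j := fst p))} \<in> sets (\<mu> \<Otimes>\<^sub>M ?S)"
    by (simp add: pred_def split_def)
  have "AE z in ?S. AE y in \<mu>. P (z(j := y))"
    using AE by simp
  \<comment> \<open>The hypothesis fixes the sequence first, whereas the product measure at hand has
    the new entry as its first factor, so the two quantifiers are exchanged.\<close>
  then have "AE y in \<mu>. AE z in ?S. P (z(j := y))"
    by (simp only: sw.AE_commute[of "\<lambda>y z. P (z(j := y))", OF pred])
  then have "AE p in \<mu> \<Otimes>\<^sub>M ?S. P ((snd p)(j := fst p))"
    by (intro sw.AE_pair_measure pred) simp
  then have "AE x in distr (\<mu> \<Otimes>\<^sub>M ?S) ?S (\<lambda>(y, z). z(j := y)). P x"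
    using assms(2) by (subst AE_distr_iff[OF upd]) (simp_all add: pred_def split_def)
  \<comment> \<open>Here \<open>j\<close> already lies in the index set \<open>UNIV\<close>, so the
    update overwrites the old entry and the index set stays the same.\<close>
  moreover have "distr (\<mu> \<Otimes>\<^sub>M ?S) ?S (\<lambda>(y, z). z(j := y)) = ?S"
    using distr_pair_PiM_eq_PiM[of UNIV "\<lambda>_. \<mu>" j] assms(1) by simp
  ultimately show ?thesis
    by (simp only:)
qed

text \<open>By independence the first \<open>k\<close> entries all miss \<open>U\<close> with
  probability \<open>?q ^ k\<close>, which tends to \<open>0\<close> because
  \<open>?q < 1\<close>.\<close>

lemma AE_PiM_hits:
  fixes \<mu> :: "'x measure"
  assumes "prob_space \<mu>" and U[measurable]: "U \<in> sets \<mu>" and "emeasure \<mu> U \<noteq> 0"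
  shows "AE x in \<Pi>\<^sub>M i\<in>(UNIV :: nat set). \<mu>. \<exists>i. x i \<in> U"
proof -
  interpret prob_space \<mu> by fact
  interpret sequence_space \<mu> ..
  let ?q = "measure \<mu> (space \<mu> - U)"
  have "?q < 1"
    using assms(3) prob_space.prob_compl[OF assms(1) U] finite_measure.emeasure_eq_measure[of \<mu> U]
    by (simp add: prob_space.finite_measure[OF assms(1)] less_le)
  \<comment> \<open>The exponent is \<open>Suc k\<close> because the product formula for countably
    many coordinates runs over the indices up to and including \<open>k\<close>.\<close>
  then have "(\<lambda>k. ?q ^ Suc k) \<longlonglongrightarrow> 0"
    by (intro LIMSEQ_Suc LIMSEQ_power_zero) simp
  moreover have "(\<lambda>k. ?q ^ Suc k) \<longlonglongrightarrow> measure S (Pi UNIV (\<lambda>_. space \<mu> - U))"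
    using measure_PiM_countable[of "\<lambda>_. space \<mu> - U"] by simp
  ultimately have "measure S (Pi UNIV (\<lambda>_. space \<mu> - U)) = 0"
    using LIMSEQ_unique by blast
  then have "Pi UNIV (\<lambda>_. space \<mu> - U) \<in> null_sets S"
    by (auto simp: null_sets_def P.emeasure_eq_measure)
  then show ?thesis
    by (rule AE_I') (auto simp: space_PiM)
qed


section \<open>Density and independence of random sequences\<close>

text \<open>The base consists of the balls of radius \<open>1 / (k + 1)\<close> around the points of
  a countable dense set.\<close>

lemma (in Metric_space) separable_countable_base:
  assumes "separable_space mtopology"
  obtains \<B> where "countable \<B>" "\<And>V. V \<in> \<B> \<Longrightarrow> openin mtopology V" "\<And>V. V \<in> \<B> \<Longrightarrow> V \<noteq> {}"
    "\<And>T x. openin mtopology T \<Longrightarrow> x \<in> T \<Longrightarrow> \<exists>V\<in>\<B>. x \<in> V \<and> V \<subseteq> T"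
proof -
  obtain C where C: "countable C" "C \<subseteq> M" "mtopology closure_of C = M"
    using assms by (auto simp: separable_space_def)
  define \<B> where "\<B> = (\<lambda>(c, k). mball c (1 / real (Suc k))) ` (C \<times> (UNIV :: nat set))"
  have base: "\<exists>V\<in>\<B>. x \<in> V \<and> V \<subseteq> T" if T: "openin mtopology T" "x \<in> T" for T x
  proof -
    obtain r where r: "r > 0" "mball x r \<subseteq> T" and x: "x \<in> M"
      using T unfolding openin_mtopology by blast
    \<comment> \<open>With radius below \<open>r / 2\<close>, a ball whose centre is that close to
      \<open>x\<close> contains \<open>x\<close> and, by the triangle inequality, stays inside
      \<open>mball x r\<close>.\<close>
    obtain k where k: "1 / real (Suc k) < r / 2"
      using nat_approx_posE[of "r / 2"] r(1) half_gt_zero by blast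
    obtain c where c: "c \<in> C" "c \<in> mball x (1 / real (Suc k))"
    proof -
      have "x \<in> mtopology closure_of C" "1 / real (Suc k) > 0"
        using C(3) x by simp_all
      then show ?thesis
        unfolding metric_closure_of using that by blast
    qed
    have "mball c (1 / real (Suc k)) \<subseteq> mball x r"
      using c k by (intro mball_subset) (auto simp: commute)
    moreover have "x \<in> mball c (1 / real (Suc k))"
      using c x by (auto simp: commute)
    moreover have "mball c (1 / real (Suc k)) \<in> \<B>"
      using c by (auto simp: \<B>_def)
    ultimately show ?thesis
      using r by blast
  qed
  show ?thesis
  proof (rule that[of \<B>])
    show "countable \<B>"
      using C by (auto simp: \<B>_def)
    fix V assume "V \<in> \<B>"
    then obtain c k where V: "V = mball c (1 / real (Suc k))" and "c \<in> C"
      by (auto simp: \<B>_def)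
    then have "c \<in> V"
      using C(2) unfolding V by (subst centre_in_mball_iff) auto
    then show "V \<noteq> {}"
      by blast
    show "openin mtopology V"
      unfolding V by (rule openin_mball)
  qed (use base in auto)
qed

lemma compatible_sets_power:
  assumes "compatible L M n X d \<mu>" "E \<subseteq> (\<Pi>\<^sub>E i\<in>{..<k}. X)"
    and "definable L M (k * n) ((\<lambda>x. concat (map x [0..<k])) ` E)"
  shows "E \<in> sets (\<Pi>\<^sub>M i\<in>{..<k}. \<mu>)"
  using assms unfolding compatible_def by blast

text \<open>Compatibility states measurability in powers of \<open>X\<close> only. The case of
  exponent \<open>1\<close> is carried back to \<open>\<mu>\<close> along the map that sends a point
  to the family with this single entry.\<close>

lemma sets_definable:
  assumes comp: "compatible L M n X d \<mu>" and sp: "space \<mu> = X"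
    and D: "definable L M n D" "D \<subseteq> X"
  shows "D \<in> sets \<mu>"
proof -
  let ?E = "\<Pi>\<^sub>E i\<in>{..<1 :: nat}. D" and ?r = "\<lambda>y. \<lambda>i\<in>{..<1 :: nat}. y"
  have "(\<lambda>x. concat (map x [0..<1])) ` ?E = D"
  proof safe
    fix y assume "y \<in> D"
    then show "y \<in> (\<lambda>x. concat (map x [0..<1])) ` ?E"
      by (intro image_eqI[of _ _ "?r y"]) auto
  qed auto
  then have "definable L M (1 * n) ((\<lambda>x. concat (map x [0..<1])) ` ?E)"
    using D(1) by simp
  moreover have "?E \<subseteq> (\<Pi>\<^sub>E i\<in>{..<1}. X)"
    using D(2) by (intro PiE_mono)
  ultimately have "?E \<in> sets (\<Pi>\<^sub>M i\<in>{..<1}. \<mu>)"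
    by (rule compatible_sets_power[OF comp, rotated])
  moreover have "?r \<in> measurable \<mu> (\<Pi>\<^sub>M i\<in>{..<1}. \<mu>)"
    by measurable
  ultimately have "?r -` ?E \<inter> space \<mu> \<in> sets \<mu>"
    by (rule measurable_sets[rotated])
  also have "?r -` ?E \<inter> space \<mu> = D"
  proof -
    have "?r y \<in> ?E \<longleftrightarrow> y \<in> D" for y
      unfolding restrict_PiE_iff by simp
    then show ?thesis
      using D(2) unfolding vimage_def sp by blast
  qed
  finally show ?thesis .
qed

text \<open>The condition depends on finitely many entries, so it is the preimage of a measurable
  subset of a finite power under \<open>?r\<close>. This map is measurable even if \<open>is\<close>
  repeats indices.\<close>

lemma measurable_models:
  fixes \<mu> :: "'a list measure"
  assumes X: "definable L M n X" and comp: "compatible L M n X d \<mu>" and sp: "space \<mu> = X"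
    and \<phi>: "formula_in L (length is * n) \<phi>"
  shows "Measurable.pred (\<Pi>\<^sub>M i\<in>(UNIV :: nat set). \<mu>) (\<lambda>x. models M \<phi> (concat (map x is)))"
proof -
  let ?k = "length is" and ?r = "\<lambda>x :: nat \<Rightarrow> 'a list. \<lambda>i\<in>{..<length is}. x (is ! i)"
  let ?E = "{x \<in> \<Pi>\<^sub>E i\<in>{..<?k}. X. models M \<phi> (concat (map x [0..<?k]))}"
  have E: "?E \<in> sets (\<Pi>\<^sub>M i\<in>{..<?k}. \<mu>)"
    by (rule compatible_sets_power[OF comp _ definable_power_Collect[OF X \<phi>]]) blast
  have r: "?r \<in> measurable (\<Pi>\<^sub>M i\<in>UNIV. \<mu>) (\<Pi>\<^sub>M i\<in>{..<?k}. \<mu>)"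
    by measurable
  have map_r: "map (?r x) [0..<?k] = map x is" for x
    by (rule nth_equalityI) simp_all
  have "?r -` ?E \<inter> space (\<Pi>\<^sub>M i\<in>UNIV. \<mu>)
      = {x \<in> space (\<Pi>\<^sub>M i\<in>UNIV. \<mu>). models M \<phi> (concat (map x is))}"
    unfolding vimage_Collect_eq Int_def mem_Collect_eq map_r by (auto simp: space_PiM sp PiE_iff)
  with measurable_sets[OF r E] show ?thesis
    by (simp only: pred_def)
qed

text \<open>One instance of independence of the range of \<open>x\<close>, phrased with indices
  instead of points so that there are only countably many instances. The pair \<open>p\<close>
  collects the formula and the indices of its parameters.\<close>

definition avoids_thin :: "('a, 'f, 'r) fo_structure \<Rightarrow> 'a list set \<Rightarrow>
    ('a list \<Rightarrow> 'a list \<Rightarrow> real) \<Rightarrow> ('f, 'r) fo_formula \<times> nat list \<Rightarrow> nat \<Rightarrow> (nat \<Rightarrow> 'a list) \<Rightarrow> bool"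
  where "avoids_thin M X d p j x \<longleftrightarrow>
    (thin X d (solutions M X (fst p) (map x (snd p))) \<longrightarrow>
     x j \<in> solutions M X (fst p) (map x (snd p)) \<longrightarrow> (\<exists>i\<in>set (snd p). x j = x i))"

lemma independent_points_range_iff:
  "independent_points L M n X d (range x) \<longleftrightarrow>
    (\<forall>p\<in>{(\<phi>, is). formula_in L (n + length is * n) \<phi>}. \<forall>j. avoids_thin M X d p j x)"
proof (intro iffI ballI allI)
  fix p :: "('a, 'b) fo_formula \<times> nat list" and j
  assume ind: "independent_points L M n X d (range x)"
    and "p \<in> {(\<phi>, is). formula_in L (n + length is * n) \<phi>}"
  then obtain \<phi> "is" where p: "p = (\<phi>, is)" and \<phi>: "formula_in L (n + length is * n) \<phi>"
    by blast
  have "map x is \<in> tuples (range x) (length is)"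
    by (auto simp: tuples_def)
  with ind \<phi> have "thin X d (solutions M X \<phi> (map x is)) \<longrightarrow>
      range x \<inter> solutions M X \<phi> (map x is) \<subseteq> set (map x is)"
    unfolding independent_points_def by blast
  then show "avoids_thin M X d p j x"
    unfolding avoids_thin_def p fst_conv snd_conv by auto
next
  assume avoids: "\<forall>p\<in>{(\<phi>, is). formula_in L (n + length is * n) \<phi>}. \<forall>j. avoids_thin M X d p j x"
  show "independent_points L M n X d (range x)"
    unfolding independent_points_def
  proof (intro allI impI ballI)
    fix m \<phi> bs
    assume \<phi>: "formula_in L (n + m * n) \<phi>" and bs: "bs \<in> tuples (range x) m"
      and thin: "thin X d (solutions M X \<phi> bs)"
    \<comment> \<open>Every parameter lies in the range of \<open>x\<close>, so an index can be
      chosen for each one.\<close>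
    obtain "is" where "is": "bs = map x is"
      using bs ex_map_conv[of bs x] by (auto simp: tuples_def)
    have "length is = m"
      using bs "is" by (simp add: tuples_def)
    with \<phi> avoids have "avoids_thin M X d (\<phi>, is) j x" for j
      by blast
    with thin show "range x \<inter> solutions M X \<phi> bs \<subseteq> set bs"
      unfolding avoids_thin_def "is" fst_conv snd_conv by auto
  qed
qed

text \<open>A countable family of measurable sets separates points, so equality of two entries is a
  countable conjunction. One implication for each \<open>V\<close> is enough, since
  \<open>sep\<close> may be applied with \<open>y\<close> as the point inside.\<close>

lemma measurable_eq_components:
  assumes "countable \<B>" "\<And>V. V \<in> \<B> \<Longrightarrow> V \<in> sets \<mu>"
    and sep: "\<And>y z. y \<in> space \<mu> \<Longrightarrow> z \<in> space \<mu> \<Longrightarrow> y \<noteq> z \<Longrightarrow> \<exists>V\<in>\<B>. y \<in> V \<and> z \<notin> V"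
  shows "Measurable.pred (\<Pi>\<^sub>M i\<in>(UNIV :: nat set). \<mu>) (\<lambda>x. x i = x j)"
proof -
  let ?S = "\<Pi>\<^sub>M i\<in>(UNIV :: nat set). \<mu>"
  have "Measurable.pred ?S (\<lambda>x. \<forall>V\<in>\<B>. x i \<in> V \<longrightarrow> x j \<in> V)"
  proof (rule measurable_pred_countable(1)[OF assms(1)])
    fix V assume "V \<in> \<B>"
    then have [measurable]: "V \<in> sets \<mu>"
      by (rule assms(2))
    show "Measurable.pred ?S (\<lambda>x. x i \<in> V \<longrightarrow> x j \<in> V)"
      by measurable
  qed
  moreover have "(x i = x j) = (\<forall>V\<in>\<B>. x i \<in> V \<longrightarrow> x j \<in> V)" if "x \<in> space ?S" for x
  proof -
    have "x i \<in> space \<mu>" "x j \<in> space \<mu>"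
      using that by (auto simp: space_PiM)
    then show ?thesis
      using sep by metis
  qed
  ultimately show ?thesis
    by (simp cong: measurable_cong)
qed

text \<open>Definability of thickness replaces the quantification over balls by satisfaction of a
  formula \<open>\<psi>\<close> in the parameters. The condition is then a Boolean combination of
  satisfaction conditions and equalities of entries.\<close>

lemma measurable_avoids_thin:
  fixes \<mu> :: "'a list measure"
  assumes X: "definable L M n X" and comp: "compatible L M n X d \<mu>" and sp: "space \<mu> = X"
    and td: "thickness_definable L M n X d"
    and eq[measurable]: "\<And>i j. Measurable.pred (\<Pi>\<^sub>M i\<in>(UNIV :: nat set). \<mu>) (\<lambda>x. x i = x j)"
    and \<phi>: "formula_in L (n + length is * n) \<phi>"
  shows "Measurable.pred (\<Pi>\<^sub>M i\<in>(UNIV :: nat set). \<mu>) (avoids_thin M X d (\<phi>, is) j)"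
proof -
  let ?S = "\<Pi>\<^sub>M i\<in>(UNIV :: nat set). \<mu>"
  obtain \<psi> where \<psi>: "formula_in L (length is * n) \<psi>"
    and thick: "\<forall>bs \<in> tuples X (length is).
      models M \<psi> (concat bs) \<longleftrightarrow> thick X d (solutions M X \<phi> bs)"
    using td \<phi> unfolding thickness_definable_def by meson
  have [measurable]: "Measurable.pred ?S (\<lambda>x. models M \<psi> (concat (map x is)))"
    by (rule measurable_models[OF X comp sp \<psi>])
  \<comment> \<open>The tested point is read as the first block, so membership in the solution set
    is satisfaction at the entries with indices \<open>j # is\<close>.\<close>
  have "formula_in L (length (j # is) * n) \<phi>"
    using \<phi> by simp
  from measurable_models[OF X comp sp this]
  have [measurable]: "Measurable.pred ?S (\<lambda>x. models M \<phi> (x j @ concat (map x is)))"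
    by simp
  have "Measurable.pred ?S (\<lambda>x. \<not> models M \<psi> (concat (map x is)) \<longrightarrow>
      models M \<phi> (x j @ concat (map x is)) \<longrightarrow> (\<exists>i\<in>set is. x j = x i))"
    by measurable
  moreover have "avoids_thin M X d (\<phi>, is) j x \<longleftrightarrow> (\<not> models M \<psi> (concat (map x is)) \<longrightarrow>
      models M \<phi> (x j @ concat (map x is)) \<longrightarrow> (\<exists>i\<in>set is. x j = x i))" if "x \<in> space ?S" for x
  proof -
    have "x i \<in> X" for i
      using that by (auto simp: space_PiM sp)
    moreover from this have "map x is \<in> tuples X (length is)"
      by (auto simp: tuples_def)
    ultimately show ?thesis
      using thick by (simp add: avoids_thin_def solutions_def)
  qed
  ultimately show ?thesis
    by (simp cong: measurable_cong)
qed

text \<open>All entries but the \<open>j\<close>-th are fixed and that one is resampled. If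
  \<open>j\<close> is not among the parameter indices, the solution set does not move with it, so a
  thin solution set is avoided almost surely.\<close>

lemma AE_avoids_thin:
  fixes \<mu> :: "'a list measure"
  assumes X: "definable L M n X" and comp: "compatible L M n X d \<mu>"
    and prob: "prob_space \<mu>" and sp: "space \<mu> = X"
    and meas: "Measurable.pred (\<Pi>\<^sub>M i\<in>(UNIV :: nat set). \<mu>) (avoids_thin M X d (\<phi>, is) j)"
    and \<phi>: "formula_in L (n + length is * n) \<phi>"
  shows "AE x in \<Pi>\<^sub>M i\<in>(UNIV :: nat set). \<mu>. avoids_thin M X d (\<phi>, is) j x"
proof (cases "j \<in> set is")
  case True
  \<comment> \<open>The index \<open>j\<close> itself witnesses the conclusion
    \<open>x j = x i\<close>.\<close>
  then have "avoids_thin M X d (\<phi>, is) j x" for x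
    unfolding avoids_thin_def by auto
  then show ?thesis
    by simp
next
  case False
  show ?thesis
  proof (rule AE_PiM_update[OF prob meas])
    fix z assume z: "z \<in> space (\<Pi>\<^sub>M i\<in>(UNIV :: nat set). \<mu>)"
    let ?D = "solutions M X \<phi> (map z is)"
    have upd: "map (z(j := y)) is = map z is" for y
      using False by (intro map_cong) auto
    have avoids: "avoids_thin M X d (\<phi>, is) j (z(j := y))" if "thin X d ?D \<longrightarrow> y \<notin> ?D" for y
      using that unfolding avoids_thin_def fst_conv snd_conv upd fun_upd_same by blast
    show "AE y in \<mu>. avoids_thin M X d (\<phi>, is) j (z(j := y))"
    proof (cases "thick X d ?D")
      case True
      then show ?thesis
        using avoids by simp
    next
      case thin: False
      have "map z is \<in> tuples X (length is)"
        using z by (auto simp: tuples_def space_PiM sp)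
      then have def: "definable L M n ?D"
        by (rule definable_solutions[OF X \<phi>])
      have sub: "?D \<subseteq> X"
        unfolding solutions_def by blast
      have "emeasure \<mu> ?D = 0"
        using comp thin def sub unfolding compatible_def by blast
      then have "?D \<in> null_sets \<mu>"
        using sets_definable[OF comp sp def sub] by (intro null_setsI)
      then have "AE y in \<mu>. y \<notin> ?D"
        by (rule AE_not_in)
      then show ?thesis
        by eventually_elim (use avoids in blast)
    qed
  qed
qed

theorem theorem3p8:
  fixes L :: "('f, 'r) fo_language"
    and M :: "('a, 'f, 'r) fo_structure"
    and n :: nat
    and X :: "'a list set"
    and d :: "'a list \<Rightarrow> 'a list \<Rightarrow> real"
    and \<mu> :: "'a list measure"
  assumes "Metric_space X d"
    and "compact_space (Metric_space.mtopology X d)"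
    and "separable_space (Metric_space.mtopology X d)"
    and no_isolated: "\<forall>x \<in> X. \<not> openin (Metric_space.mtopology X d) {x}"
    and "defining_structure L M n X d"
    and "borel_probability_on X d \<mu>"
    and "compatible L M n X d \<mu>"
    and "full_support X d \<mu>"
    and "countable_language L"
    and "thickness_definable L M n X d"
  defines "G \<equiv> {x \<in> (\<Pi>\<^sub>E i \<in> (UNIV :: nat set). X).
                  dense_in_space X d (range x) \<and> independent_points L M n X d (range x)}"
  shows "G \<in> sets (\<Pi>\<^sub>M i \<in> (UNIV :: nat set). \<mu>) \<and>
         emeasure (\<Pi>\<^sub>M i \<in> (UNIV :: nat set). \<mu>)
           (space (\<Pi>\<^sub>M i \<in> (UNIV :: nat set). \<mu>) - G) = 0"
proof -
  let ?S = "\<Pi>\<^sub>M i \<in> (UNIV :: nat set). \<mu>"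
  interpret Metric_space X d by fact
  have prob: "prob_space \<mu>" and sp: "space \<mu> = X"
    and open_sets: "\<And>U. openin mtopology U \<Longrightarrow> U \<in> sets \<mu>"
    using assms(6) unfolding borel_probability_on_def by blast+
  have X: "definable L M n X"
    using assms(5) unfolding defining_structure_def by blast
  have space_S: "space ?S = (\<Pi>\<^sub>E i \<in> UNIV. X)"
    by (simp add: space_PiM sp)
  obtain \<B> where \<B>: "countable \<B>" "\<And>V. V \<in> \<B> \<Longrightarrow> openin mtopology V" "\<And>V. V \<in> \<B> \<Longrightarrow> V \<noteq> {}"
    and base: "\<And>T x. openin mtopology T \<Longrightarrow> x \<in> T \<Longrightarrow> \<exists>V\<in>\<B>. x \<in> V \<and> V \<subseteq> T"
    using separable_countable_base[OF assms(3)] by metis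
  have \<B>_sets: "V \<in> sets \<mu>" if "V \<in> \<B>" for V
    using \<B>(2)[OF that] by (rule open_sets)

  have dense_iff: "dense_in_space X d (range x) \<longleftrightarrow> (\<forall>V\<in>\<B>. \<exists>i. x i \<in> V)" for x :: "nat \<Rightarrow> 'a list"
  proof -
    have "dense_in_space X d (range x) \<longleftrightarrow>
        (\<forall>T. openin mtopology T \<and> T \<noteq> {} \<longrightarrow> range x \<inter> T \<noteq> {})"
      using dense_intersects_open[of mtopology "range x"]
      unfolding dense_in_space_def topspace_mtopology .
    also have "\<dots> \<longleftrightarrow> (\<forall>V\<in>\<B>. \<exists>i. x i \<in> V)"
    proof (intro iffI ballI allI impI)
      fix V assume *: "\<forall>T. openin mtopology T \<and> T \<noteq> {} \<longrightarrow> range x \<inter> T \<noteq> {}" and "V \<in> \<B>"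
      then have "range x \<inter> V \<noteq> {}"
        using \<B>(2,3)[OF \<open>V \<in> \<B>\<close>] by blast
      then show "\<exists>i. x i \<in> V"
        by blast
    next
      fix T assume *: "\<forall>V\<in>\<B>. \<exists>i. x i \<in> V" and T: "openin mtopology T \<and> T \<noteq> {}"
      then obtain y where "y \<in> T"
        by blast
      then obtain V where "V \<in> \<B>" "V \<subseteq> T"
        using base T by blast
      then show "range x \<inter> T \<noteq> {}"
        using * by blast
    qed
    finally show ?thesis .
  qed
  have dense_meas: "Measurable.pred ?S (\<lambda>x. \<forall>V\<in>\<B>. \<exists>i. x i \<in> V)"
  proof (rule measurable_pred_countable(1)[OF \<B>(1)])
    fix V assume "V \<in> \<B>"
    note [measurable] = \<B>_sets[OF this]
    show "Measurable.pred ?S (\<lambda>x. \<exists>i. x i \<in> V)"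
      by measurable
  qed
  \<comment> \<open>Each base set contains a ball, which has positive measure by full support; base
    sets need not be definable, so compatibility would not give this.\<close>
  have \<B>_pos: "emeasure \<mu> V \<noteq> 0" if "V \<in> \<B>" for V
  proof -
    obtain x where "x \<in> V"
      using \<B>(3) \<open>V \<in> \<B>\<close> by blast
    then obtain r where "x \<in> X" "r > 0" "mball x r \<subseteq> V"
      using \<B>(2)[OF \<open>V \<in> \<B>\<close>] unfolding openin_mtopology by blast
    then have "emeasure \<mu> (mball x r) \<noteq> 0" "emeasure \<mu> (mball x r) \<le> emeasure \<mu> V"
      using assms(8) \<B>_sets[OF \<open>V \<in> \<B>\<close>] unfolding full_support_def by (blast intro: emeasure_mono)+
    then show ?thesis
      by (metis le_zero_eq)
  qed
  have dense_AE: "AE x in ?S. \<forall>V\<in>\<B>. \<exists>i. x i \<in> V"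
    unfolding AE_ball_countable[OF \<B>(1)]
    by (intro ballI AE_PiM_hits[OF prob] \<B>_sets \<B>_pos)

  have eq_meas: "Measurable.pred ?S (\<lambda>x. x i = x j)" for i j :: nat
  proof (rule measurable_eq_components[OF \<B>(1) \<B>_sets])
    fix y z assume "y \<in> space \<mu>" "z \<in> space \<mu>" "y \<noteq> z"
    \<comment> \<open>The open ball around \<open>y\<close> of radius \<open>d y z\<close> just
      excludes \<open>z\<close>, and a base set between \<open>y\<close> and this ball separates the
      two points.\<close>
    then have "y \<in> mball y (d y z)" "z \<notin> mball y (d y z)"
      using mdist_pos_less[of y z] by (simp_all add: sp)
    then show "\<exists>V\<in>\<B>. y \<in> V \<and> z \<notin> V"
      using base[OF openin_mball, of y y "d y z"] by blast
  qed

  \<comment> \<open>The number of parameters is the length of the index list, so a pair of a formula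
    and an index list records everything; \<open>F\<close> is countable since \<open>L\<close>
    is.\<close>
  define F where "F = {(\<phi>, is :: nat list). formula_in L (n + length is * n) \<phi>}"
  have "F \<subseteq> {\<phi>. formula_of L \<phi>} \<times> UNIV"
    unfolding F_def formula_in_def by blast
  then have F: "countable F"
    by (rule countable_subset) (intro countable_SIGMA countable_formulas[OF assms(9)] countableI_type)
  have indep_meas: "Measurable.pred ?S (avoids_thin M X d p j)" if "p \<in> F" for p j
    using that measurable_avoids_thin[OF X assms(7) sp assms(10) eq_meas]
    unfolding F_def by blast
  have indep_AE: "AE x in ?S. avoids_thin M X d p j x" if "p \<in> F" for p j
    using that AE_avoids_thin[OF X assms(7) prob sp] indep_meas[OF that, of j]
    unfolding F_def by blast

  have G_eq: "G = {x \<in> space ?S. (\<forall>V\<in>\<B>. \<exists>i. x i \<in> V) \<and> (\<forall>p\<in>F. \<forall>j. avoids_thin M X d p j x)}"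
    unfolding G_def dense_iff independent_points_range_iff space_S F_def ..
  have "Measurable.pred ?S (\<lambda>x. \<forall>p\<in>F. \<forall>j. avoids_thin M X d p j x)"
    by (intro measurable_pred_countable(1)[OF F] pred_intros_countable(1) indep_meas)
  with dense_meas have meas: "G \<in> sets ?S"
    unfolding G_eq by (intro predE pred_intros_logic)
  have "AE x in ?S. \<forall>p\<in>F. \<forall>j. avoids_thin M X d p j x"
    unfolding AE_ball_countable[OF F] AE_all_countable by (intro ballI allI indep_AE)
  with dense_AE AE_space have "AE x in ?S. x \<in> G"
    unfolding G_eq by eventually_elim blast
  \<comment> \<open>Measurability of \<open>G\<close> makes the exceptional set itself a null set,
    rather than merely a subset of one.\<close>
  then have "emeasure ?S {x \<in> space ?S. x \<notin> G} = 0"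
    using meas by (subst (asm) AE_iff_measurable[OF _ refl]) auto
  moreover have "{x \<in> space ?S. x \<notin> G} = space ?S - G"
    by blast
  ultimately show ?thesis
    using meas by simp
qed

end
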